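(* Let $h\in\Bbbk[x]$ be monic of degree $N\geq 1$ with zero coefficient of $x^{N-1}$. Let $w\in A_h$, let $s(x)\in\Bbbk[x]$ with $\deg(s)<\deg(h)$, and let $D=ad_w+\Delta_{s(x)}\in\operatorname{Der}(A_h)$. Then $$\operatorname{Aut}_D(A_h)=\{\rho=\sigma_{r(x)}\circ\tau_a\in\operatorname{Aut}(A_h)\ \mid\ \rho(w)-w\in\Bbbk,\ s(ax)=a^{N-1}s(x)\}.$$
   Context: $\Bbbk$ is an algebraically closed field of characteristic zero. $A_h=\Bbbk[x][t;d]$, $d=h(x)\partial_x$, is the associative unital $\Bbbk$-algebra generated by $x,t$ subject to $tx=xt+h(x)$. $\operatorname{Aut}(A_h)$ and $\operatorname{Der}(A_h)$ denote $\Bbbk$-algebra automorphisms and $\Bbbk$-derivations; for $\delta\in\operatorname{Der}(A_h)$, $\operatorname{Aut}_\delta(A_h)=\{\rho\in\operatorname{Aut}(A_h)\mid\rho\delta=\delta\rho\}$. For $w\in A_h$, $ad_w(u)=wu-uw$. $\Delta_{s(x)}$ is the derivation of $A_h$ with $\Delta_{s(x)}(x)=0$, $\Delta_{s(x)}(t)=s(x)$. The degree of the zero polynomial is $-\infty$. For $h$ monic of degree $N\ge1$ with zero coefficient of $x^{N-1}$, it is known that every automorphism of $A_h$ is uniquely of the form $\sigma_{r(x)}\circ\tau_a$ with $r(x)\in\Bbbk[x]$ and $a\in\Bbbk^\ast$ satisfying $h(ax)=a^Nh(x)$, where $\sigma_{r(x)}(x)=x$, $\sigma_{r(x)}(t)=t+r(x)$,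 $\tau_a(x)=ax$, $\tau_a(t)=a^{N-1}t$ (and all of these are automorphisms). *)

theory Defs
  imports
    "HOL-Computational_Algebra.Polynomial"
    "HOL-Algebra.QuotRing"
begin

text \<open>
  An element of the Ore extension A_h = k[x][t; d], d = h d/dx, is written uniquely as
  sum_i p_i(x) t^i; it is represented by the polynomial with coefficients p_i, of type
  'k poly poly. Addition and scalars are those of that type, but the multiplication
  of A_h is \<open>skew_mult h\<close> below, not the commutative \<open>(*)\<close> of the type.
  Left multiplication by t is forced by t p(x) = p(x) t + h(x) p'(x).
\<close>

definition t_mult :: "'k::field poly \<Rightarrow> 'k poly poly \<Rightarrow> 'k poly poly" where
  "t_mult h g = pCons 0 g + map_poly (\<lambda>p. h * pderiv p) g"

definition skew_mult :: "'k::field poly \<Rightarrow> 'k poly poly \<Rightarrow> 'k poly poly \<Rightarrow> 'k poly poly" where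
  "skew_mult h f g = (\<Sum>i\<le>degree f. smult (coeff f i) ((t_mult h ^^ i) g))"

definition Ah :: "'k::field poly \<Rightarrow> 'k poly poly ring" where
  "Ah h = \<lparr>carrier = UNIV, mult = skew_mult h, one = 1, zero = 0, add = (+)\<rparr>"

definition emb :: "'k::field poly \<Rightarrow> 'k poly poly" where
  "emb p = [:p:]"

definition scal :: "'k::field \<Rightarrow> 'k poly poly" where
  "scal c = emb [:c:]"

definition gx :: "'k::field poly poly" where
  "gx = emb [:0, 1:]"

definition gt :: "'k::field poly poly" where
  "gt = [:0, 1:]"

definition Endo :: "'k::field poly \<Rightarrow> ('k poly poly \<Rightarrow> 'k poly poly) set" where
  "Endo h = {\<phi> \<in> ring_hom (Ah h) (Ah h). \<forall>c. \<phi> (scal c) = scal c}"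

definition Aut :: "'k::field poly \<Rightarrow> ('k poly poly \<Rightarrow> 'k poly poly) set" where
  "Aut h = {\<phi> \<in> ring_iso (Ah h) (Ah h). \<forall>c. \<phi> (scal c) = scal c}"

definition Der :: "'k::field poly \<Rightarrow> ('k poly poly \<Rightarrow> 'k poly poly) set" where
  "Der h = {\<delta>. (\<forall>u v. \<delta> (u + v) = \<delta> u + \<delta> v) \<and>
               (\<forall>c u. \<delta> (smult [:c:] u) = smult [:c:] (\<delta> u)) \<and>
               (\<forall>u v. \<delta> (u \<otimes>\<^bsub>Ah h\<^esub> v) = \<delta> u \<otimes>\<^bsub>Ah h\<^esub> v + u \<otimes>\<^bsub>Ah h\<^esub> \<delta> v)}"

definition Aut_commuting ::
    "'k::field poly \<Rightarrow> ('k poly poly \<Rightarrow> 'k poly poly) \<Rightarrow> ('k poly poly \<Rightarrow> 'k poly poly) set" where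
  "Aut_commuting h \<delta> = {\<rho> \<in> Aut h. \<rho> \<circ> \<delta> = \<delta> \<circ> \<rho>}"

definition ad :: "'k::field poly \<Rightarrow> 'k poly poly \<Rightarrow> 'k poly poly \<Rightarrow> 'k poly poly" where
  "ad h w u = w \<otimes>\<^bsub>Ah h\<^esub> u - u \<otimes>\<^bsub>Ah h\<^esub> w"

text \<open>
  \<open>subst_gen h u v\<close> sends sum_ij c_ij x^j t^i to sum_ij c_ij u^j v^i, computed in A_h.
  It is the algebra endomorphism with x \<mapsto> u and t \<mapsto> v whenever there is one
  (\<open>Endo_unique\<close>).
\<close>

definition subst_gen ::
    "'k::field poly \<Rightarrow> 'k poly poly \<Rightarrow> 'k poly poly \<Rightarrow> 'k poly poly \<Rightarrow> 'k poly poly" where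
  "subst_gen h u v f =
     (\<Sum>i\<le>degree f. \<Sum>j\<le>degree (coeff f i).
        smult [:coeff (coeff f i) j:] ((u [^]\<^bsub>Ah h\<^esub> j) \<otimes>\<^bsub>Ah h\<^esub> (v [^]\<^bsub>Ah h\<^esub> i)))"

definition sigma :: "'k::field poly \<Rightarrow> 'k poly \<Rightarrow> 'k poly poly \<Rightarrow> 'k poly poly" where
  "sigma h r = subst_gen h gx (gt + emb r)"

definition tau :: "'k::field poly \<Rightarrow> 'k \<Rightarrow> 'k poly poly \<Rightarrow> 'k poly poly" where
  "tau h a = subst_gen h (smult [:a:] gx) (smult [:a ^ (degree h - 1):] gt)"

text \<open>
  The k[x]-linear map with t^i \<mapsto> sum_(j<i) t^j s t^(i-1-j): the derivation with
  x \<mapsto> 0 and t \<mapsto> s (\<open>Delta_Der\<close>, \<open>Delta_gx\<close>, \<open>Delta_gt\<close>, \<open>Der_unique\<close>).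
\<close>

definition Delta :: "'k::field poly \<Rightarrow> 'k poly \<Rightarrow> 'k poly poly \<Rightarrow> 'k poly poly" where
  "Delta h s f =
     (\<Sum>i\<le>degree f. smult (coeff f i)
        (\<Sum>j<i. (gt [^]\<^bsub>Ah h\<^esub> j) \<otimes>\<^bsub>Ah h\<^esub> emb s \<otimes>\<^bsub>Ah h\<^esub> (gt [^]\<^bsub>Ah h\<^esub> (i - 1 - j))))"

lemma t_mult_add: "t_mult h (f + g) = t_mult h f + t_mult h g"
  by (rule poly_eqI) (simp add: t_mult_def coeff_map_poly coeff_pCons pderiv_add
      algebra_simps split: nat.split)

lemma t_mult_0 [simp]: "t_mult h 0 = 0"
  by (simp add: t_mult_def)

lemma t_mult_smult: "t_mult h (smult p g) = smult p (t_mult h g) + smult (h * pderiv p) g"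
  by (rule poly_eqI) (simp add: t_mult_def coeff_map_poly coeff_pCons pderiv_mult
      algebra_simps split: nat.split)

lemma t_mult_sum: "t_mult h (sum F I) = (\<Sum>i\<in>I. t_mult h (F i))"
  by (induction I rule: infinite_finite_induct) (simp_all add: t_mult_add)

lemma t_pow_add: "(t_mult h ^^ i) (f + g) = (t_mult h ^^ i) f + (t_mult h ^^ i) g"
  by (induction i) (simp_all add: t_mult_add)

lemma skew_mult_bound:
  assumes "degree f \<le> n"
  shows "skew_mult h f g = (\<Sum>i\<le>n. smult (coeff f i) ((t_mult h ^^ i) g))"
  unfolding skew_mult_def
  by (rule sum.mono_neutral_left) (use assms in \<open>auto simp: coeff_eq_0\<close>)

lemma skew_add_left: "skew_mult h (f + g) k = skew_mult h f k + skew_mult h g k"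
proof -
  let ?n = "max (degree f) (degree g)"
  have "skew_mult h (f + g) k = (\<Sum>i\<le>?n. smult (coeff (f + g) i) ((t_mult h ^^ i) k))"
    by (rule skew_mult_bound) (rule degree_add_le_max)
  also have "\<dots> = skew_mult h f k + skew_mult h g k"
    by (simp add: skew_mult_bound[of f ?n] skew_mult_bound[of g ?n] smult_add_left sum.distrib)
  finally show ?thesis .
qed

lemma skew_add_right: "skew_mult h f (g + k) = skew_mult h f g + skew_mult h f k"
  by (simp add: skew_mult_def t_pow_add smult_add_right sum.distrib)

lemma skew_0_left [simp]: "skew_mult h 0 g = 0"
  by (simp add: skew_mult_def)

lemma skew_0_right [simp]: "skew_mult h f 0 = 0"
  by (metis add.right_neutral add_left_imp_eq skew_add_right)

lemma smult_sum': "smult (c::'a::comm_semiring_0) (sum F I) = (\<Sum>i\<in>I. smult c (F i))"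
  by (induction I rule: infinite_finite_induct) (simp_all add: smult_add_right)

lemma skew_smult_left: "skew_mult h (smult p f) g = smult p (skew_mult h f g)"
  by (simp add: skew_mult_bound[of "smult p f" "degree f"] skew_mult_def smult_sum')

lemma skew_pCons: "skew_mult h (pCons p f) g = smult p g + skew_mult h f (t_mult h g)"
proof -
  have "degree (pCons p f) \<le> Suc (degree f)"
    by (rule degree_pCons_le)
  then have "skew_mult h (pCons p f) g
      = (\<Sum>i\<le>Suc (degree f). smult (coeff (pCons p f) i) ((t_mult h ^^ i) g))"
    by (rule skew_mult_bound)
  then show ?thesis
    by (subst (asm) sum.atMost_Suc_shift) (simp add: skew_mult_def funpow_swap1)
qed

lemma skew_t_mult_left: "skew_mult h (t_mult h f) g = t_mult h (skew_mult h f g)"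
proof (induction f arbitrary: g)
  case (pCons p f)
  have "t_mult h (pCons p f) = pCons 0 [:p:] + [:h * pderiv p:] + pCons 0 (t_mult h f)"
    by (rule poly_eqI) (auto simp: t_mult_def coeff_map_poly coeff_pCons split: nat.split)
  then show ?case
    by (simp add: skew_add_left skew_pCons pCons.IH t_mult_add t_mult_smult algebra_simps)
qed simp

lemma skew_assoc: "skew_mult h (skew_mult h f g) k = skew_mult h f (skew_mult h g k)"
proof (induction f arbitrary: g)
  case (pCons p f)
  then show ?case
    by (simp add: skew_pCons skew_add_left skew_smult_left skew_t_mult_left)
qed simp

lemma skew_1_left [simp]: "skew_mult h 1 g = g"
  by (simp add: skew_mult_def)

lemma skew_const_left: "skew_mult h [:p:] g = smult p g"
  by (simp add: skew_pCons)

lemma skew_gt_left: "skew_mult h gt g = t_mult h g"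
  by (simp add: gt_def skew_pCons)

lemma t_mult_1: "t_mult h 1 = gt"
  by (rule poly_eqI) (simp add: t_mult_def gt_def coeff_map_poly coeff_pCons coeff_1 pderiv_1
      split: nat.split)

lemma t_pow_1: "(t_mult h ^^ i) 1 = monom 1 i"
proof (induction i)
  case (Suc i)
  have "map_poly (\<lambda>p. h * pderiv p) (monom 1 i) = 0"
    by (rule poly_eqI) (simp add: coeff_map_poly)
  then show ?case
    using Suc by (simp add: t_mult_def monom_Suc)
qed (simp add: monom_0 one_pCons)

lemma skew_1_right [simp]: "skew_mult h f 1 = f"
  by (simp add: skew_mult_def t_pow_1 smult_monom poly_as_sum_of_monoms)

lemma Ah_simps [simp]:
  "carrier (Ah h) = UNIV" "mult (Ah h) = skew_mult h" "one (Ah h) = 1"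
  "zero (Ah h) = 0" "add (Ah h) = (+)"
  by (simp_all add: Ah_def)

lemma ring_Ah: "ring (Ah h)"
proof (rule ringI)
  show "abelian_group (Ah h)"
    by (rule abelian_groupI) (auto simp: add.assoc add.commute intro: exI[of _ "- _"])
  show "Group.monoid (Ah h)"
    by (rule monoidI) (simp_all add: skew_assoc)
qed (simp_all add: skew_add_left skew_add_right)

interpretation Ah: ring "Ah h" for h :: "'k::field poly"
  by (rule ring_Ah)

lemma scal_one: "scal 1 = 1" and scal_zero: "scal 0 = 0"
  and scal_add: "scal (a + b) = scal a + scal b"
  by (simp_all add: scal_def emb_def one_pCons)

lemma scal_mult: "scal c \<otimes>\<^bsub>Ah h\<^esub> u = smult [:c:] u"
  by (simp add: scal_def emb_def skew_const_left)

lemma skew_smult_right: "skew_mult h f (smult [:c:] g) = smult [:c:] (skew_mult h f g)"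
proof (induction f arbitrary: g)
  case (pCons p f)
  have "t_mult h (smult [:c:] g) = smult [:c:] (t_mult h g)"
    by (simp add: t_mult_smult pderiv_pCons)
  then show ?case
    using pCons by (simp add: skew_pCons smult_add_right mult.commute)
qed simp

lemma scal_central: "u \<otimes>\<^bsub>Ah h\<^esub> scal c = scal c \<otimes>\<^bsub>Ah h\<^esub> u"
proof -
  have "scal c = smult [:c:] 1"
    by (simp add: scal_def emb_def one_pCons)
  then show ?thesis
    using skew_smult_right[of h u c 1] scal_mult[of h c u] by simp
qed

lemma defining_relation: "gt \<otimes>\<^bsub>Ah h\<^esub> gx = gx \<otimes>\<^bsub>Ah h\<^esub> gt + emb h"
proof -
  have "gt \<otimes>\<^bsub>Ah h\<^esub> gx = t_mult h gx"
    by (simp add: skew_gt_left)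
  then show ?thesis
    by (simp add: gx_def emb_def skew_const_left gt_def t_mult_def map_poly_pCons pderiv_pCons)
qed

lemma emb_mult: "emb p \<otimes>\<^bsub>Ah h\<^esub> emb q = emb (p * q)"
  and emb_add: "emb (p + q) = emb p + emb q"
  and emb_one: "emb 1 = 1"
  by (simp_all add: emb_def skew_const_left one_pCons)

lemma gt_pow: "gt [^]\<^bsub>Ah h\<^esub> (i::nat) = monom 1 i"
proof -
  have "gt [^]\<^bsub>Ah h\<^esub> i = (t_mult h ^^ i) 1"
  proof (induction i)
    case (Suc i)
    have "gt [^]\<^bsub>Ah h\<^esub> Suc i = gt \<otimes>\<^bsub>Ah h\<^esub> (gt [^]\<^bsub>Ah h\<^esub> i)"
      by (simp only: Ah.nat_pow_Suc2 Ah_simps UNIV_I)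
    then show ?case
      using Suc by (simp add: skew_gt_left)
  qed (simp add: Ah.nat_pow_0)
  then show ?thesis
    by (simp add: t_pow_1)
qed

lemma gx_pow: "gx [^]\<^bsub>Ah h\<^esub> (j::nat) = emb (monom 1 j)"
proof (induction j)
  case (Suc j)
  have "gx [^]\<^bsub>Ah h\<^esub> Suc j = emb (monom 1 j) \<otimes>\<^bsub>Ah h\<^esub> gx"
    using Suc by simp
  also have "\<dots> = emb (monom 1 j * [:0, 1:])"
    by (simp only: gx_def emb_mult)
  finally show ?case
    by (simp add: monom_Suc)
qed (simp add: emb_one)

lemma subst_gen_id: "subst_gen h gx gt f = f"
proof -
  have "(\<Sum>j\<le>degree p. smult [:coeff p j:] ((gx [^]\<^bsub>Ah h\<^esub> j) \<otimes>\<^bsub>Ah h\<^esub> (gt [^]\<^bsub>Ah h\<^esub> i)))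
      = monom p i" for p :: "'a poly" and i
  proof -
    have "(\<Sum>j\<le>degree p. smult [:coeff p j:] ((gx [^]\<^bsub>Ah h\<^esub> j) \<otimes>\<^bsub>Ah h\<^esub> (gt [^]\<^bsub>Ah h\<^esub> i)))
      = (\<Sum>j\<le>degree p. monom (monom (coeff p j) j) i)"
      by (simp add: gx_pow gt_pow emb_def skew_const_left smult_monom)
    also have "\<dots> = monom (\<Sum>j\<le>degree p. monom (coeff p j) j) i"
      by (rule poly_eqI) (simp add: coeff_sum)
    finally show ?thesis
      by (simp add: poly_as_sum_of_monoms)
  qed
  then show ?thesis
    by (simp add: subst_gen_def poly_as_sum_of_monoms)
qed

lemma subst_gen_gx: "subst_gen h u v gx = u"
  by (simp add: subst_gen_def gx_def emb_def flip: one_pCons)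

lemma subst_gen_gt: "subst_gen h u v gt = v"
  by (simp add: subst_gen_def gt_def flip: one_pCons)

lemma ring_hom_sum:
  assumes "\<phi> \<in> ring_hom (Ah h) (Ah h)"
  shows "\<phi> (sum F I) = (\<Sum>i\<in>I. \<phi> (F i))"
proof -
  have add: "\<phi> (a + b) = \<phi> a + \<phi> b" for a b
    using ring_hom_add[OF assms, of a b] by simp
  then have "\<phi> 0 = 0"
    by (metis add.right_neutral add_left_imp_eq)
  then show ?thesis
    by (induction I rule: infinite_finite_induct) (simp_all add: add)
qed

lemma ring_hom_pow:
  assumes "\<phi> \<in> ring_hom (Ah h) (Ah h)"
  shows "\<phi> (u [^]\<^bsub>Ah h\<^esub> (n::nat)) = \<phi> u [^]\<^bsub>Ah h\<^esub> n"
  using ring_hom_mult[OF assms] ring_hom_one[OF assms]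
  by (induction n) simp_all

lemma Endo_unique:
  assumes "\<phi> \<in> Endo h"
  shows "\<phi> = subst_gen h (\<phi> gx) (\<phi> gt)"
proof
  fix f
  have hom: "\<phi> \<in> ring_hom (Ah h) (Ah h)" and sc: "\<phi> (scal c) = scal c" for c
    using assms by (auto simp: Endo_def)
  have mult: "\<phi> (a \<otimes>\<^bsub>Ah h\<^esub> b) = \<phi> a \<otimes>\<^bsub>Ah h\<^esub> \<phi> b" for a b
    using ring_hom_mult[OF hom, of a b] by simp
  have lin: "\<phi> (smult [:c:] a) = smult [:c:] (\<phi> a)" for c a
    using mult[of "scal c" a] by (simp only: scal_mult sc)
  have "\<phi> f = \<phi> (subst_gen h gx gt f)"
    by (simp only: subst_gen_id)
  also have "\<dots> = subst_gen h (\<phi> gx) (\<phi> gt) f"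
    by (simp only: subst_gen_def ring_hom_sum[OF hom] lin mult ring_hom_pow[OF hom])
  finally show "\<phi> f = subst_gen h (\<phi> gx) (\<phi> gt) f" .
qed

text \<open>The endomorphism with x \<mapsto> u and t \<mapsto> v exists if v u = u v + h(u)
  (\<open>subst_gen_Endo\<close>); \<open>ev h u p\<close> is p(u) computed in A_h.\<close>

definition ev :: "'k::field poly \<Rightarrow> 'k poly poly \<Rightarrow> 'k poly \<Rightarrow> 'k poly poly" where
  "ev h u p = (\<Sum>j\<le>degree p. smult [:coeff p j:] (u [^]\<^bsub>Ah h\<^esub> j))"

lemma skew_sum_left: "skew_mult h (sum F I) g = (\<Sum>i\<in>I. skew_mult h (F i) g)"
  by (induction I rule: infinite_finite_induct) (simp_all add: skew_add_left)

lemma skew_sum_right: "skew_mult h f (sum F I) = (\<Sum>i\<in>I. skew_mult h f (F i))"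
  by (induction I rule: infinite_finite_induct) (simp_all add: skew_add_right)

lemma pow_commute:
  "skew_mult h (u [^]\<^bsub>Ah h\<^esub> (n::nat)) u = skew_mult h u (u [^]\<^bsub>Ah h\<^esub> n)"
  by (metis Ah.nat_pow_Suc Ah.nat_pow_Suc2 Ah_simps(1,2) UNIV_I)

lemma ev_bound:
  assumes "degree p \<le> n"
  shows "ev h u p = (\<Sum>j\<le>n. smult [:coeff p j:] (u [^]\<^bsub>Ah h\<^esub> j))"
  unfolding ev_def
  by (rule sum.mono_neutral_left) (use assms in \<open>auto simp: coeff_eq_0\<close>)

lemma ev_0 [simp]: "ev h u 0 = 0"
  by (simp add: ev_def)

lemma ev_pCons: "ev h u (pCons c p) = scal c + skew_mult h u (ev h u p)"
proof -
  have "ev h u (pCons c p)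
      = (\<Sum>j\<le>Suc (degree p). smult [:coeff (pCons c p) j:] (u [^]\<^bsub>Ah h\<^esub> j))"
    by (rule ev_bound) (rule degree_pCons_le)
  then show ?thesis
    by (subst (asm) sum.atMost_Suc_shift)
      (simp add: ev_def skew_sum_right skew_smult_right pow_commute scal_def emb_def
        flip: one_pCons)
qed

lemma ev_add: "ev h u (p + q) = ev h u p + ev h u q"
proof -
  let ?n = "max (degree p) (degree q)"
  have "ev h u (p + q) = (\<Sum>j\<le>?n. smult [:coeff (p + q) j:] (u [^]\<^bsub>Ah h\<^esub> j))"
    by (rule ev_bound) (rule degree_add_le_max)
  also have "\<dots> = (\<Sum>j\<le>?n. smult [:coeff p j:] (u [^]\<^bsub>Ah h\<^esub> j) + smult [:coeff q j:] (u [^]\<^bsub>Ah h\<^esub> j))"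
    by (intro sum.cong refl) (simp flip: smult_add_left)
  also have "\<dots> = ev h u p + ev h u q"
    by (simp add: ev_bound[of p ?n] ev_bound[of q ?n] sum.distrib)
  finally show ?thesis .
qed

lemma ev_smult: "ev h u (smult c p) = smult [:c:] (ev h u p)"
  by (simp add: ev_bound[of "smult c p" "degree p"] ev_def smult_sum'
      mult.commute)

lemma ev_mult: "ev h u (p * q) = skew_mult h (ev h u p) (ev h u q)"
proof (induction p)
  case (pCons c p)
  have "skew_mult h (scal c) g = smult [:c:] g" for g
    by (simp add: scal_def emb_def skew_const_left)
  moreover have "scal 0 = (0 :: 'a poly poly)"
    by (rule scal_zero)
  ultimately show ?case
    using pCons
    by (simp add: ev_add ev_smult ev_pCons skew_add_left skew_assoc)
qed simp

lemma subst_gen_ev: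
  "subst_gen h u v f = (\<Sum>i\<le>degree f. skew_mult h (ev h u (coeff f i)) (v [^]\<^bsub>Ah h\<^esub> i))"
  by (simp add: subst_gen_def ev_def skew_sum_left skew_smult_left)

lemma subst_gen_bound:
  assumes "degree f \<le> n"
  shows "subst_gen h u v f = (\<Sum>i\<le>n. skew_mult h (ev h u (coeff f i)) (v [^]\<^bsub>Ah h\<^esub> i))"
  unfolding subst_gen_ev
  by (rule sum.mono_neutral_left) (use assms in \<open>auto simp: coeff_eq_0\<close>)

lemma subst_gen_0 [simp]: "subst_gen h u v 0 = 0"
  by (simp add: subst_gen_def)

lemma subst_gen_pCons:
  "subst_gen h u v (pCons p f) = ev h u p + skew_mult h (subst_gen h u v f) v"
proof -
  have "subst_gen h u v (pCons p f)
      = (\<Sum>i\<le>Suc (degree f). skew_mult h (ev h u (coeff (pCons p f) i)) (v [^]\<^bsub>Ah h\<^esub> i))"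
    by (rule subst_gen_bound) (rule degree_pCons_le)
  then show ?thesis
    by (subst (asm) sum.atMost_Suc_shift)
      (simp add: subst_gen_ev skew_sum_left skew_assoc)
qed

lemma subst_gen_add: "subst_gen h u v (f + g) = subst_gen h u v f + subst_gen h u v g"
proof -
  let ?n = "max (degree f) (degree g)"
  have "subst_gen h u v (f + g)
      = (\<Sum>i\<le>?n. skew_mult h (ev h u (coeff (f + g) i)) (v [^]\<^bsub>Ah h\<^esub> i))"
    by (rule subst_gen_bound) (rule degree_add_le_max)
  also have "\<dots> = subst_gen h u v f + subst_gen h u v g"
    by (simp add: subst_gen_bound[of f ?n] subst_gen_bound[of g ?n] ev_add skew_add_left
        sum.distrib)
  finally show ?thesis .
qed

lemma subst_gen_smult:
  "subst_gen h u v (smult p f) = skew_mult h (ev h u p) (subst_gen h u v f)"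
  by (simp add: subst_gen_bound[of "smult p f" "degree f"] subst_gen_ev ev_mult
      skew_sum_right skew_assoc)

lemma subst_gen_emb: "subst_gen h u v (emb p) = ev h u p"
  by (simp add: emb_def subst_gen_pCons)

lemma ev_gx: "ev h gx p = emb p"
  by (simp add: subst_gen_id flip: subst_gen_emb[of h gx gt])

lemma ev_one: "ev h u 1 = 1"
  by (simp add: ev_def flip: one_pCons)

lemma subst_gen_Endo:
  assumes rel: "v \<otimes>\<^bsub>Ah h\<^esub> u = u \<otimes>\<^bsub>Ah h\<^esub> v + ev h u h"
  shows "subst_gen h u v \<in> Endo h"
proof -
  let ?\<phi> = "subst_gen h u v"
  have vev: "skew_mult h v (ev h u p) = skew_mult h (ev h u p) v + ev h u (h * pderiv p)" for p
  proof (induction p)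
    case (pCons c p)
    have 1: "skew_mult h v (scal c) = skew_mult h (scal c) v"
      using scal_central[of h v c] by simp
    have "skew_mult h v (skew_mult h u (ev h u p))
        = skew_mult h (skew_mult h u v + ev h u h) (ev h u p)"
      using rel by (simp flip: skew_assoc)
    also have "\<dots> = skew_mult h u (skew_mult h (ev h u p) v + ev h u (h * pderiv p))
        + ev h u (h * p)"
      by (simp add: skew_add_left skew_assoc pCons.IH ev_mult)
    also have "skew_mult h u (ev h u (h * pderiv p)) = ev h u (pCons 0 (h * pderiv p))"
      by (simp add: ev_pCons scal_zero)
    then have "skew_mult h u (skew_mult h (ev h u p) v + ev h u (h * pderiv p)) + ev h u (h * p)
        = skew_mult h (skew_mult h u (ev h u p)) v + ev h u (h * pderiv (pCons c p))"
      by (simp add: skew_add_right skew_assoc pderiv_pCons algebra_simps flip: ev_add)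
    finally show ?case
      by (simp add: ev_pCons skew_add_left skew_add_right 1)
  qed simp
  have vmult: "?\<phi> (t_mult h f) = skew_mult h v (?\<phi> f)" for f
  proof (induction f)
    case (pCons p f)
    have "t_mult h (pCons p f) = pCons 0 [:p:] + [:h * pderiv p:] + pCons 0 (t_mult h f)"
      by (rule poly_eqI) (auto simp: t_mult_def coeff_map_poly coeff_pCons split: nat.split)
    then have "?\<phi> (t_mult h (pCons p f)) = ?\<phi> (pCons 0 [:p:]) + ?\<phi> [:h * pderiv p:]
        + ?\<phi> (pCons 0 (t_mult h f))"
      by (simp only: subst_gen_add)
    then show ?case
      by (simp add: subst_gen_pCons pCons.IH skew_add_right skew_assoc vev)
  qed simp
  have mult: "?\<phi> (skew_mult h f g) = skew_mult h (?\<phi> f) (?\<phi> g)" for f g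
  proof (induction f arbitrary: g)
    case (pCons p f)
    then show ?case
      by (simp add: skew_pCons subst_gen_add subst_gen_smult subst_gen_pCons vmult skew_add_left
          skew_assoc)
  qed simp
  have sc: "?\<phi> (scal c) = scal c" for c
    by (simp add: scal_def subst_gen_emb ev_pCons)
  have "?\<phi> \<in> ring_hom (Ah h) (Ah h)"
    by (rule ring_hom_memI) (use sc[of 1] in \<open>simp_all add: mult subst_gen_add scal_one\<close>)
  then show ?thesis
    using sc by (simp add: Endo_def)
qed

lemma Endo_comp: "\<phi> \<in> Endo h \<Longrightarrow> \<psi> \<in> Endo h \<Longrightarrow> \<phi> \<circ> \<psi> \<in> Endo h"
  by (auto simp: Endo_def ring_hom_def)

lemma Endo_eqI:
  assumes "\<phi> \<in> Endo h" "\<psi> \<in> Endo h" "\<phi> gx = \<psi> gx" "\<phi> gt = \<psi> gt"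
  shows "\<phi> = \<psi>"
  using Endo_unique[OF assms(1)] Endo_unique[OF assms(2)] assms(3,4) by simp

lemma id_Endo: "id \<in> Endo h"
  by (auto simp: Endo_def ring_hom_def)

lemma Endo_add: "\<phi> \<in> Endo h \<Longrightarrow> \<phi> (a + b) = \<phi> a + \<phi> b"
  unfolding Endo_def using ring_hom_add[of \<phi> "Ah h" "Ah h" a b] by simp

lemma Endo_smult: "\<phi> \<in> Endo h \<Longrightarrow> \<phi> (smult [:c:] a) = smult [:c:] (\<phi> a)"
  unfolding Endo_def
  using ring_hom_mult[of \<phi> "Ah h" "Ah h" "scal c" a] scal_mult[of h c a] scal_mult[of h c "\<phi> a"]
  by simp

lemma Aut_if_inverse:
  assumes "\<phi> \<in> Endo h" "\<psi> \<in> Endo h"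
    and "\<phi> (\<psi> gx) = gx" "\<phi> (\<psi> gt) = gt" "\<psi> (\<phi> gx) = gx" "\<psi> (\<phi> gt) = gt"
  shows "\<phi> \<in> Aut h"
proof -
  have "\<phi> \<circ> \<psi> = id" "\<psi> \<circ> \<phi> = id"
    by (rule Endo_eqI[of _ h]; use assms in \<open>simp add: Endo_comp id_Endo\<close>)+
  then have "bij \<phi>"
    by (metis o_bij)
  then show ?thesis
    using assms(1) by (auto simp: Aut_def Endo_def ring_iso_def)
qed

lemma sigma_gx: "sigma h r gx = gx" and sigma_gt: "sigma h r gt = gt + emb r"
  by (simp_all add: sigma_def subst_gen_gx subst_gen_gt)

lemma sigma_Endo: "sigma h r \<in> Endo h"
proof -
  have "skew_mult h (emb r) gx = skew_mult h gx (emb r)"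
    using emb_mult[of h r "[:0, 1:]"] emb_mult[of h "[:0, 1:]" r]
    by (simp add: gx_def mult.commute)
  then show ?thesis
    unfolding sigma_def
    using defining_relation[of h]
    by (intro subst_gen_Endo) (simp add: skew_add_left skew_add_right ev_gx)
qed

lemma sigma_emb: "sigma h r (emb p) = emb p"
  by (simp add: sigma_def subst_gen_emb ev_gx)

lemma sigma_Aut: "sigma h r \<in> Aut h"
  by (rule Aut_if_inverse[of _ _ "sigma h (- r)"])
    (simp_all add: sigma_Endo sigma_gx sigma_gt Endo_add[OF sigma_Endo] sigma_emb add.assoc
      flip: emb_add, simp_all add: emb_def)

lemma tau_gx: "tau h a gx = smult [:a:] gx"
  and tau_gt: "tau h a gt = smult [:a ^ (degree h - 1):] gt"
  by (simp_all add: tau_def subst_gen_gx subst_gen_gt)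

lemma ev_scaled_gx: "ev h (smult [:a:] gx) p = emb (pcompose p [:0, a:])"
proof (induction p)
  case (pCons c p)
  have "skew_mult h (smult [:a:] gx) (emb q) = emb ([:0, a:] * q)" for q
    using emb_mult[of h "[:0, a:]" q] by (simp add: gx_def emb_def)
  then show ?case
    using pCons by (simp add: ev_pCons pcompose_pCons scal_def flip: emb_add)
qed (simp add: emb_def)

lemma tau_Endo:
  assumes "degree h \<ge> 1" "pcompose h [:0, a:] = smult (a ^ degree h) h"
  shows "tau h a \<in> Endo h"
  unfolding tau_def
proof (rule subst_gen_Endo)
  let ?N = "degree h"
  have N: "a ^ (?N - 1) * a = a ^ ?N"
    using assms(1) by (simp add: power_eq_if)
  have "skew_mult h gt gx = skew_mult h gx gt + emb h"
    using defining_relation[of h] by simp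
  moreover have "smult [:a ^ ?N:] (emb h) = emb (smult (a ^ ?N) h)"
    by (simp add: emb_def)
  ultimately show "smult [:a ^ (?N - 1):] gt \<otimes>\<^bsub>Ah h\<^esub> smult [:a:] gx
      = smult [:a:] gx \<otimes>\<^bsub>Ah h\<^esub> smult [:a ^ (?N - 1):] gt + ev h (smult [:a:] gx) h"
    using N
    by (simp add: skew_smult_left skew_smult_right ev_scaled_gx assms(2) smult_add_right
        mult.commute)
qed

lemma tau_Aut:
  assumes "degree h \<ge> 1" "a \<noteq> 0" "pcompose h [:0, a:] = smult (a ^ degree h) h"
  shows "tau h a \<in> Aut h"
proof -
  have "h = pcompose (pcompose h [:0, a:]) [:0, inverse a:]"
    using assms(2) by (simp add: pcompose_pCons flip: pcompose_assoc)
  also have "\<dots> = smult (a ^ degree h) (pcompose h [:0, inverse a:])"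
    by (simp add: assms(3) pcompose_smult)
  finally have "smult (inverse a ^ degree h) h
      = smult (inverse a ^ degree h) (smult (a ^ degree h) (pcompose h [:0, inverse a:]))"
    by simp
  then have inv: "pcompose h [:0, inverse a:] = smult (inverse a ^ degree h) h"
    using assms(2) by (simp flip: power_mult_distrib)
  have E: "tau h a \<in> Endo h" "tau h (inverse a) \<in> Endo h"
    using assms inv by (simp_all add: tau_Endo)
  show ?thesis
    by (rule Aut_if_inverse[OF E])
      (use assms(2) in \<open>simp_all add: tau_gx tau_gt Endo_smult[OF E(1)] Endo_smult[OF E(2)]
         one_pCons[symmetric] flip: power_mult_distrib\<close>)
qed

lemma ad_Der: "ad h w \<in> Der h"
proof -
  have minus: "skew_mult h (- f) g = - skew_mult h f g" "skew_mult h f (- g) = - skew_mult h f g"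
    for f g
    using skew_add_left[of h f "- f" g] skew_add_right[of h f g "- g"]
    by (simp_all add: eq_neg_iff_add_eq_0 add.commute)
  have "skew_mult h (f - g) k = skew_mult h f k - skew_mult h g k"
    "skew_mult h k (f - g) = skew_mult h k f - skew_mult h k g" for f g k
    using skew_add_left[of h f "- g" k] skew_add_right[of h k f "- g"] by (simp_all add: minus)
  then show ?thesis
    by (simp add: Der_def ad_def skew_add_left skew_add_right skew_smult_left skew_smult_right
        skew_assoc smult_diff_right)
qed

lemma Der_add: "\<delta> \<in> Der h \<Longrightarrow> \<epsilon> \<in> Der h \<Longrightarrow> (\<lambda>u. \<delta> u + \<epsilon> u) \<in> Der h"
  by (simp add: Der_def skew_add_left skew_add_right smult_add_right)

lemma Der_0: "\<delta> \<in> Der h \<Longrightarrow> \<delta> 0 = 0"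
proof -
  assume "\<delta> \<in> Der h"
  then have "\<delta> (0 + 0) = \<delta> 0 + \<delta> 0"
    unfolding Der_def by blast
  then show ?thesis
    by (metis add.right_neutral add_left_imp_eq)
qed

lemma Der_unique:
  assumes "\<delta> \<in> Der h" "\<epsilon> \<in> Der h" "\<delta> gx = \<epsilon> gx" "\<delta> gt = \<epsilon> gt"
  shows "\<delta> = \<epsilon>"
proof
  fix f
  let ?S = "{u. \<delta> u = \<epsilon> u}"
  have zero: "0 \<in> ?S"
    using Der_0[OF assms(1)] Der_0[OF assms(2)] by simp
  have add: "a + b \<in> ?S" if "a \<in> ?S" "b \<in> ?S" for a b
    using that assms(1,2) by (simp add: Der_def)
  have smult: "smult [:c:] a \<in> ?S" if "a \<in> ?S" for a c
    using that assms(1,2) by (simp add: Der_def)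
  have mult: "a \<otimes>\<^bsub>Ah h\<^esub> b \<in> ?S" if "a \<in> ?S" "b \<in> ?S" for a b
    using that assms(1,2) by (simp add: Der_def)
  have one: "1 \<in> ?S"
  proof -
    have *: "\<theta> 1 = 0" if "\<theta> \<in> Der h" for \<theta>
    proof -
      have "\<theta> (1 \<otimes>\<^bsub>Ah h\<^esub> 1) = \<theta> 1 \<otimes>\<^bsub>Ah h\<^esub> 1 + 1 \<otimes>\<^bsub>Ah h\<^esub> \<theta> 1"
        using that unfolding Der_def by blast
      then have "\<theta> 1 = \<theta> 1 + \<theta> 1"
        by simp
      then show ?thesis
        by (metis add.right_neutral add_left_imp_eq)
    qed
    show ?thesis
      using *[OF assms(1)] *[OF assms(2)] by simp
  qed
  have pow: "a [^]\<^bsub>Ah h\<^esub> (n::nat) \<in> ?S" if "a \<in> ?S" for a n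
  proof (induction n)
    case (Suc n)
    then show ?case
      using mult[OF Suc that] by simp
  qed (use one in simp)
  have sum: "sum F I \<in> ?S" if "\<And>i. F i \<in> ?S" for F and I :: "nat set"
    by (induction I rule: infinite_finite_induct) (use that zero add in auto)
  have "subst_gen h gx gt f \<in> ?S"
    unfolding subst_gen_def
    by (intro sum smult mult pow) (use assms(3,4) in auto)
  then show "\<delta> f = \<epsilon> f"
    by (simp add: subst_gen_id)
qed

lemma Delta_gx: "Delta h s gx = 0"
  by (simp add: Delta_def gx_def emb_def)

lemma Delta_gt: "Delta h s gt = emb s"
  by (simp add: Delta_def gt_def)

definition delta_pow :: "'k::field poly \<Rightarrow> 'k poly \<Rightarrow> nat \<Rightarrow> 'k poly poly" where
  "delta_pow h s i =
     (\<Sum>j<i. (gt [^]\<^bsub>Ah h\<^esub> j) \<otimes>\<^bsub>Ah h\<^esub> emb s \<otimes>\<^bsub>Ah h\<^esub> (gt [^]\<^bsub>Ah h\<^esub> (i - 1 - j)))"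

lemma delta_pow_Suc:
  "delta_pow h s (Suc i) = skew_mult h (delta_pow h s i) gt
     + skew_mult h (gt [^]\<^bsub>Ah h\<^esub> i) (emb s)"
proof -
  have "skew_mult h (gt [^]\<^bsub>Ah h\<^esub> (i - 1 - j)) gt = gt [^]\<^bsub>Ah h\<^esub> (i - j)" if "j < i" for j
  proof -
    have "i - j = Suc (i - 1 - j)"
      using that by simp
    then show ?thesis
      by simp
  qed
  then show ?thesis
    by (simp add: delta_pow_def skew_sum_left skew_assoc)
qed

lemma Delta_bound:
  assumes "degree f \<le> n"
  shows "Delta h s f = (\<Sum>i\<le>n. smult (coeff f i) (delta_pow h s i))"
  unfolding Delta_def delta_pow_def[symmetric]
  by (rule sum.mono_neutral_left) (use assms in \<open>auto simp: coeff_eq_0\<close>)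

lemma Delta_0 [simp]: "Delta h s 0 = 0"
  by (simp add: Delta_def)

lemma Delta_add: "Delta h s (f + g) = Delta h s f + Delta h s g"
proof -
  let ?n = "max (degree f) (degree g)"
  have "Delta h s (f + g) = (\<Sum>i\<le>?n. smult (coeff (f + g) i) (delta_pow h s i))"
    by (rule Delta_bound) (rule degree_add_le_max)
  also have "\<dots> = Delta h s f + Delta h s g"
    by (simp add: Delta_bound[of f ?n] Delta_bound[of g ?n] smult_add_left sum.distrib)
  finally show ?thesis .
qed

lemma Delta_smult: "Delta h s (smult p f) = smult p (Delta h s f)"
  by (simp add: Delta_bound[of "smult p f" "degree f"] Delta_bound[of f "degree f"] smult_sum')

lemma Delta_pCons:
  "Delta h s (pCons p f) = skew_mult h (Delta h s f) gt + skew_mult h f (emb s)"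
proof -
  have "Delta h s (pCons p f)
      = (\<Sum>i\<le>Suc (degree f). smult (coeff (pCons p f) i) (delta_pow h s i))"
    by (rule Delta_bound) (rule degree_pCons_le)
  also have "\<dots> = (\<Sum>i\<le>degree f. smult (coeff f i) (delta_pow h s (Suc i)))"
    by (subst sum.atMost_Suc_shift) (simp add: delta_pow_def)
  also have "\<dots> = skew_mult h (Delta h s f) gt
      + (\<Sum>i\<le>degree f. smult (coeff f i) (skew_mult h (gt [^]\<^bsub>Ah h\<^esub> i) (emb s)))"
    by (simp add: delta_pow_Suc Delta_bound[of f "degree f"] skew_sum_left skew_smult_left
        smult_add_right sum.distrib)
  also have "(\<Sum>i\<le>degree f. smult (coeff f i) (skew_mult h (gt [^]\<^bsub>Ah h\<^esub> i) (emb s)))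
      = skew_mult h (\<Sum>i\<le>degree f. monom (coeff f i) i) (emb s)"
    by (simp add: skew_sum_left gt_pow smult_monom flip: skew_smult_left)
  finally show ?thesis
    by (simp add: poly_as_sum_of_monoms)
qed

lemma Delta_t_mult: "Delta h s (t_mult h f) = smult s f + t_mult h (Delta h s f)"
proof (induction f)
  case (pCons p f)
  have "t_mult h (pCons p f) = pCons 0 [:p:] + [:h * pderiv p:] + pCons 0 (t_mult h f)"
    by (rule poly_eqI) (auto simp: t_mult_def coeff_map_poly coeff_pCons split: nat.split)
  then have "Delta h s (t_mult h (pCons p f))
      = Delta h s (pCons 0 [:p:]) + Delta h s [:h * pderiv p:] + Delta h s (pCons 0 (t_mult h f))"
    by (simp only: Delta_add)
  also have "\<dots> = smult p (emb s) + skew_mult h (smult s f + t_mult h (Delta h s f)) gt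
      + skew_mult h (t_mult h f) (emb s)"
    by (simp add: Delta_pCons skew_const_left pCons.IH)
  also have "\<dots> = smult s ([:p:] + skew_mult h f gt) + t_mult h (Delta h s (pCons p f))"
    by (simp add: Delta_pCons skew_add_left skew_smult_left skew_t_mult_left t_mult_add
        smult_add_right emb_def mult.commute)
  also have "[:p:] + skew_mult h f gt = pCons p f"
    using skew_pCons[of h p f 1] by (simp add: t_mult_1)
  finally show ?case .
qed simp

lemma Delta_Der: "Delta h s \<in> Der h"
proof -
  have "Delta h s (skew_mult h f g) = skew_mult h (Delta h s f) g + skew_mult h f (Delta h s g)"
    for f g
  proof (induction f arbitrary: g)
    case (pCons p f)
    have "skew_mult h (Delta h s (pCons p f)) g
        = skew_mult h (Delta h s f) (t_mult h g) + skew_mult h f (smult s g)"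
      by (simp add: Delta_pCons skew_add_left skew_assoc skew_gt_left emb_def skew_const_left)
    then show ?case
      by (simp add: skew_pCons Delta_add Delta_smult pCons.IH Delta_t_mult skew_add_right)
  qed simp
  then show ?thesis
    by (simp add: Der_def Delta_add Delta_smult)
qed

end

theory Submission
  imports Defs
begin

text \<open>
  All commutators of A_h lie in h A_h and h = [t, x], so an automorphism maps h to a unit multiple
  of itself, i.e. to c h with c in k. As rho(h) = h(rho(x)), comparing degrees gives
  rho(x) = a x + b, the vanishing coefficient of h forces b = 0, and then rho(t) is determined up
  to the centralizer of x, which is k[x]. So rho = sigma_r o tau_a.
  If rho commutes with D, then z = rho(w) - w commutes with x, so z = p(x), and evaluating at t
  gives - a^(N-1) h p' = a^(N-1) s - s(ax). The right-hand side has smaller degree than h, hence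
  both sides vanish.
\<close>

section \<open>Products and commutators modulo h\<close>

lemma skew_diff_left: "skew_mult h (f - g) k = skew_mult h f k - skew_mult h g k"
  using skew_add_left[of h "f - g" g k] by (simp add: algebra_simps)

lemma skew_diff_right: "skew_mult h k (f - g) = skew_mult h k f - skew_mult h k g"
  using skew_add_right[of h k "f - g" g] by (simp add: algebra_simps)

lemma skew_gt_right: "skew_mult h f gt = pCons 0 f"
  using skew_pCons[of h 0 f 1] by (simp add: t_mult_1)

lemma t_mult_eq: "t_mult h g = pCons 0 g + smult h (map_poly pderiv g)"
  by (rule poly_eqI) (simp add: t_mult_def coeff_map_poly)

text \<open>Left multiplication by t differs from the commutative shift by a multiple of h, so
  modulo h the skew product is the commutative product \<open>*\<close> of k[x][t].\<close>

lemma skew_mult_mod: "\<exists>q. skew_mult h f g = f * g + smult h q"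
proof (induction f arbitrary: g)
  case 0
  show ?case
    by (auto intro: exI[of _ 0])
next
  case (pCons p f)
  obtain q where "skew_mult h f (t_mult h g) = f * t_mult h g + smult h q"
    using pCons.IH by blast
  then have "skew_mult h (pCons p f) g = pCons p f * g + smult h (f * map_poly pderiv g + q)"
    by (simp add: skew_pCons t_mult_eq distrib_left smult_add_right)
  then show ?case
    by blast
qed

lemma commutator_mod: "\<exists>q. skew_mult h f g - skew_mult h g f = smult h q"
proof -
  obtain q r where "skew_mult h f g = f * g + smult h q" "skew_mult h g f = g * f + smult h r"
    using skew_mult_mod by metis
  then have "skew_mult h f g - skew_mult h g f = smult h (q - r)"
    by (simp add: smult_diff_right mult.commute)
  then show ?thesis
    by blast
qed

section \<open>Degree in t, leading coefficients and units\<close>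

lemma coeff_t_mult:
  "coeff (t_mult h g) n = (case n of 0 \<Rightarrow> 0 | Suc m \<Rightarrow> coeff g m) + h * pderiv (coeff g n)"
  by (simp add: t_mult_def coeff_map_poly coeff_pCons split: nat.split)

lemma degree_t_mult_le: "degree g \<le> m \<Longrightarrow> degree (t_mult h g) \<le> Suc m"
  by (rule degree_le) (auto simp: coeff_t_mult coeff_eq_0 split: nat.split)

text \<open>The twist \<open>h * pderiv\<close> does not raise the degree in t, so top coefficients
  multiply as in the commutative ring. With bounds instead of exact degrees, the induction can pass
  from g to \<open>t_mult h g\<close> with bound m + 1.\<close>

lemma skew_mult_top:
  assumes "degree f \<le> n" "degree g \<le> m"
  shows "degree (skew_mult h f g) \<le> n + m \<and>
    coeff (skew_mult h f g) (n + m) = coeff f n * coeff g m"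
  using assms
proof (induction f arbitrary: g n m)
  case (pCons p f)
  show ?case
  proof (cases "f = 0")
    case True
    then show ?thesis
      using pCons.prems degree_smult_le[of p g]
      by (cases n) (auto simp: skew_pCons coeff_eq_0)
  next
    case False
    then obtain n' where n: "n = Suc n'" "degree f \<le> n'"
      using pCons.prems by (cases n) auto
    have top: "coeff (t_mult h g) (Suc m) = coeff g m"
      using pCons.prems by (simp add: coeff_t_mult coeff_eq_0)
    have IH: "degree (skew_mult h f (t_mult h g)) \<le> n' + Suc m"
      "coeff (skew_mult h f (t_mult h g)) (n' + Suc m) = coeff f n' * coeff g m"
      using pCons.IH[OF n(2) degree_t_mult_le[OF pCons.prems(2)]] top by auto
    \<comment> \<open>The constant term p contributes only below the top degree n' + 1 + m.\<close>
    have "degree (smult p g) \<le> n' + m"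
      using degree_smult_le[of p g] pCons.prems by linarith
    then have "degree (smult p g) \<le> n' + Suc m" "coeff (smult p g) (n' + Suc m) = 0"
      by (simp_all only: coeff_eq_0)
    then show ?thesis
      using IH n by (simp add: skew_pCons degree_add_le del: coeff_smult)
  qed
qed simp

lemma coeff_skew_mult_degree:
  "coeff (skew_mult h f g) (degree f + degree g) = lead_coeff f * lead_coeff g"
  using skew_mult_top[OF order_refl order_refl] by blast

lemma degree_skew_mult:
  "f \<noteq> 0 \<Longrightarrow> g \<noteq> 0 \<Longrightarrow> degree (skew_mult h f g) = degree f + degree g"
  using skew_mult_top[of f "degree f" g "degree g" h] coeff_skew_mult_degree[of h f g]
    le_degree[of "skew_mult h f g" "degree f + degree g"]
  by force

text \<open>Degrees in t add for nonzero factors, so both factors lie in k[x], whose units are the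
  nonzero constants.\<close>

lemma skew_inverse_scal:
  assumes "skew_mult h f g = 1"
  shows "\<exists>c. c \<noteq> 0 \<and> f = scal c"
proof -
  have nz: "f \<noteq> 0" "g \<noteq> 0"
    using assms by force+
  then have "degree f = 0" "degree g = 0"
    using degree_skew_mult[OF nz, of h] assms by auto
  then obtain p q where pq: "f = [:p:]" "g = [:q:]"
    by (meson degree_eq_zeroE)
  then have "p * q = 1"
    using assms by (simp add: skew_const_left one_pCons)
  then have "is_unit p"
    by (metis dvd_triv_left)
  then show ?thesis
    using pq by (auto simp: is_unit_poly_iff scal_def emb_def)
qed

section \<open>Commutators with x and the centralizer of x\<close>

text \<open>Moving each of n+1 factors t past x leaves a copy of h, so the commutator of t^(n+1)
  with x has leading term (n+1) h t^n.\<close>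

lemma commutator_gx_top:
  assumes "degree f \<le> Suc n"
  shows "coeff (skew_mult h f gx - skew_mult h gx f) n = of_nat (Suc n) * h * coeff f (Suc n)"
  using assms
proof (induction f arbitrary: n)
  case (pCons p f)
  let ?C = "\<lambda>f. skew_mult h f gx - skew_mult h gx f"
  have deg: "degree f \<le> n"
    using pCons.prems by (cases "f = 0") auto
  have "skew_mult h (pCons p f) gx
      = smult p gx + skew_mult h (skew_mult h f gx) gt + skew_mult h f (emb h)"
    using defining_relation[of h]
    by (simp add: skew_pCons skew_add_right skew_assoc flip: skew_gt_left)
  \<comment> \<open>Since \<open>pCons p f\<close> is p + f t and p commutes with x, the relation t
    x = x t + h gives [p + f t, x] = [f, x] t + f h.\<close>
  then have rec: "?C (pCons p f) = pCons 0 (?C f) + skew_mult h f (emb h)"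
    by (simp add: skew_gt_right gx_def emb_def skew_const_left mult.commute)
  have "degree (emb h) \<le> 0"
    by (simp add: emb_def)
  then have top: "coeff (skew_mult h f (emb h)) n = h * coeff f n"
    using skew_mult_top[OF deg, of "emb h" 0 h] by (simp add: emb_def mult.commute)
  have "coeff (pCons 0 (?C f)) n = of_nat n * h * coeff f n"
  proof (cases n)
    case (Suc m)
    then show ?thesis
      using pCons.IH[of m] deg by simp
  qed simp
  then show ?case
    unfolding rec coeff_add top by (simp add: algebra_simps)
qed simp

text \<open>In characteristic zero, the top coefficient (n+1) h f_(n+1) of the commutator is nonzero
  as soon as f has positive degree n+1 in t.\<close>

lemma centralizer_gx:
  fixes h :: "'k::field_char_0 poly"
  assumes "h \<noteq> 0" "skew_mult h f gx = skew_mult h gx f"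
  shows "\<exists>p. f = emb p"
proof -
  have "degree f = 0"
  proof (rule ccontr)
    assume "degree f \<noteq> 0"
    then obtain n where n: "degree f = Suc n"
      by (cases "degree f") auto
    then have "of_nat (Suc n) * h * lead_coeff f = 0"
      using commutator_gx_top[of f n h] assms(2) by simp
    moreover have "lead_coeff f \<noteq> 0"
      using n by (metis degree_0 leading_coeff_0_iff nat.distinct(1))
    ultimately show False
      using assms(1) by (simp del: of_nat_Suc)
  qed
  then show ?thesis
    by (metis degree_eq_zeroE emb_def)
qed

section \<open>Substitution into polynomials\<close>

text \<open>In Horner's scheme, multiplying by u raises the degree in t by that of u, and the
  constant added next has lower degree.\<close>

lemma degree_ev:
  assumes "degree u > 0" "p \<noteq> 0"
  shows "ev h u p \<noteq> 0 \<and> degree (ev h u p) = degree p * degree u"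
  using assms(2)
proof (induction p)
  case (pCons c p)
  show ?case
  proof (cases "p = 0")
    case True
    then show ?thesis
      using pCons.hyps by (simp add: ev_pCons scal_def emb_def)
  next
    case False
    then have IH: "ev h u p \<noteq> 0" "degree (ev h u p) = degree p * degree u"
      using pCons by auto
    have "u \<noteq> 0"
      using assms(1) by auto
    then have d: "degree (skew_mult h u (ev h u p)) = degree (pCons c p) * degree u"
      using IH False by (simp add: degree_skew_mult)
    have "degree (scal c) < degree (skew_mult h u (ev h u p))"
      using d False assms(1) by (simp add: scal_def emb_def)
    then have "degree (ev h u (pCons c p)) = degree (pCons c p) * degree u"
      using d by (simp add: ev_pCons degree_add_eq_right)
    then show ?thesis
      using False assms(1) by auto
  qed
qed simp

lemma ev_emb: "ev h (emb q) p = emb (pcompose p q)"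
proof (induction p)
  case (pCons c p)
  then show ?case
    using emb_mult[of h q "pcompose p q"]
    by (simp add: ev_pCons pcompose_pCons scal_def flip: emb_add)
qed (simp add: emb_def)

lemma coeff_pcompose_linear_top:
  fixes a b :: "'a::comm_ring_1"
  shows "degree p \<le> n \<Longrightarrow> coeff (pcompose p [:b, a:]) n = a ^ n * coeff p n"
proof (induction p arbitrary: n)
  case (pCons c p)
  show ?case
  proof (cases n)
    case 0
    then have "p = 0"
      using pCons.prems by (cases "p = 0") auto
    then show ?thesis
      using 0 by (simp add: pcompose_pCons)
  next
    case (Suc m)
    then have deg: "degree p \<le> m"
      using pCons.prems by (cases "p = 0") auto
    then have "coeff (pcompose p [:b, a:]) (Suc m) = 0"
      using pCons.IH[of "Suc m"] by (simp add: coeff_eq_0)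
    then show ?thesis
      using pCons.IH[OF deg] Suc by (simp add: pcompose_pCons)
  qed
qed simp

text \<open>Only (a x + b)^n and (a x + b)^(n+1) reach x^n; by the binomial theorem the latter
  contributes (n+1) b a^n.\<close>

lemma coeff_pcompose_linear_subtop:
  fixes a b :: "'a::comm_ring_1"
  shows "degree p \<le> Suc n \<Longrightarrow>
    coeff (pcompose p [:b, a:]) n = a ^ n * (coeff p n + of_nat (Suc n) * b * coeff p (Suc n))"
proof (induction p arbitrary: n)
  case (pCons c p)
  have deg: "degree p \<le> n"
    using pCons.prems by (cases "p = 0") auto
  have top: "coeff (pcompose p [:b, a:]) n = a ^ n * coeff p n"
    by (rule coeff_pcompose_linear_top[OF deg])
  show ?case
  proof (cases n)
    case 0
    then show ?thesis
      using top by (simp add: pcompose_pCons)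
  next
    case (Suc m)
    then show ?thesis
      using top pCons.IH[of m] deg by (simp add: pcompose_pCons algebra_simps)
  qed
qed simp

section \<open>The image of h under an automorphism\<close>

lemma Aut_Endo: "\<phi> \<in> Aut h \<Longrightarrow> \<phi> \<in> Endo h"
  by (auto simp: Aut_def Endo_def ring_iso_def)

lemma Endo_mult: "\<phi> \<in> Endo h \<Longrightarrow> \<phi> (skew_mult h a b) = skew_mult h (\<phi> a) (\<phi> b)"
  unfolding Endo_def using ring_hom_mult[of \<phi> "Ah h" "Ah h" a b] by simp

lemma Endo_diff: "\<phi> \<in> Endo h \<Longrightarrow> \<phi> (a - b) = \<phi> a - \<phi> b"
  using Endo_add[of \<phi> h "a - b" b] by (simp add: algebra_simps)

lemma Endo_emb: "\<phi> \<in> Endo h \<Longrightarrow> \<phi> (emb p) = ev h (\<phi> gx) p"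
  using Endo_unique subst_gen_emb by metis

lemma emb_h_commutator: "emb h = skew_mult h gt gx - skew_mult h gx gt"
  using defining_relation[of h] by simp

text \<open>As h is the commutator of t and x, its image is a commutator too and lies in h
  A_h.\<close>

lemma Endo_emb_h:
  assumes "\<phi> \<in> Endo h"
  shows "\<exists>q. \<phi> (emb h) = skew_mult h (emb h) q"
proof -
  have "\<phi> (emb h) = skew_mult h (\<phi> gt) (\<phi> gx) - skew_mult h (\<phi> gx) (\<phi> gt)"
    by (subst emb_h_commutator) (simp add: Endo_diff[OF assms] Endo_mult[OF assms])
  then show ?thesis
    using commutator_mod[of h "\<phi> gt" "\<phi> gx"] by (simp add: emb_def skew_const_left)
qed

text \<open>\<open>Aut\<close> provides only a bijective homomorphism; its inverse has to be one as
  well, so that \<open>Endo_emb_h\<close> applies to it.\<close>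

lemma Aut_inverse:
  assumes "\<rho> \<in> Aut h"
  obtains \<psi> where "\<psi> \<in> Endo h" "\<And>u. \<rho> (\<psi> u) = u"
proof
  have E: "\<rho> \<in> Endo h" and bij: "bij \<rho>"
    using assms by (auto simp: Aut_Endo Aut_def ring_iso_def)
  show inv: "\<rho> (inv_into UNIV \<rho> u) = u" for u
    using bij by (simp add: bij_is_surj f_inv_into_f)
  have eq: "inv_into UNIV \<rho> u = v" if "u = \<rho> v" for u v
    using bij that by (simp add: bij_is_inj)
  have sc: "\<rho> (scal c) = scal c" for c
    using assms by (auto simp: Aut_def)
  have "inv_into UNIV \<rho> \<in> ring_hom (Ah h) (Ah h)"
    by (rule ring_hom_memI)
      (use sc[of 1] in \<open>auto intro!: eq simp: Endo_mult[OF E] Endo_add[OF E] inv scal_one\<close>)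
  moreover have "inv_into UNIV \<rho> (scal c) = scal c" for c
    by (rule eq) (simp add: sc)
  ultimately show "inv_into UNIV \<rho> \<in> Endo h"
    by (simp add: Endo_def)
qed

text \<open>Applying \<open>Endo_emb_h\<close> to \<rho> and to its inverse gives h = h u \<rho>(v).
  Cancelling h makes u a unit, hence a nonzero constant.\<close>

lemma Aut_emb_h:
  assumes "h \<noteq> 0" "\<rho> \<in> Aut h"
  shows "\<exists>c. c \<noteq> 0 \<and> \<rho> (emb h) = emb (smult c h)"
proof -
  have E: "\<rho> \<in> Endo h"
    using assms by (simp add: Aut_Endo)
  obtain \<psi> where \<psi>: "\<psi> \<in> Endo h" "\<And>u. \<rho> (\<psi> u) = u"
    using Aut_inverse[OF assms(2)] by blast
  obtain u v where u: "\<rho> (emb h) = skew_mult h (emb h) u" and v: "\<psi> (emb h) = skew_mult h (emb h) v"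
    using Endo_emb_h[OF E] Endo_emb_h[OF \<psi>(1)] by blast
  have "emb h = skew_mult h (emb h) (skew_mult h u (\<rho> v))"
    using \<psi>(2)[of "emb h"] by (simp add: v Endo_mult[OF E] u skew_assoc)
  then have "smult h (skew_mult h u (\<rho> v) - 1) = 0"
    by (simp add: emb_def skew_const_left smult_diff_right one_pCons)
  then have "skew_mult h u (\<rho> v) = 1"
    using assms(1) by simp
  then obtain c where "c \<noteq> 0" "u = scal c"
    using skew_inverse_scal by blast
  then show ?thesis
    using u by (auto simp: scal_def emb_def skew_const_left)
qed

section \<open>The form of an automorphism\<close>

lemma sigma_tau_gx: "sigma h r (tau h a gx) = smult [:a:] gx"
  by (simp add: tau_gx Endo_smult[OF sigma_Endo] sigma_gx)

lemma sigma_tau_gt: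
  "sigma h r (tau h a gt) = smult [:a ^ (degree h - 1):] (gt + emb r)"
  by (simp add: tau_gt Endo_smult[OF sigma_Endo] sigma_gt)

lemma Aut_gx:
  fixes h :: "'k::field_char_0 poly"
  assumes h: "lead_coeff h = 1" "degree h \<ge> 1" "coeff h (degree h - 1) = 0"
    and \<rho>: "\<rho> \<in> Aut h"
  shows "\<exists>a. a \<noteq> 0 \<and> pcompose h [:0, a:] = smult (a ^ degree h) h \<and> \<rho> gx = smult [:a:] gx"
proof -
  let ?N = "degree h"
  have E: "\<rho> \<in> Endo h"
    using \<rho> by (rule Aut_Endo)
  have h0: "h \<noteq> 0"
    using h(2) by auto
  obtain c where c: "c \<noteq> 0" "\<rho> (emb h) = emb (smult c h)"
    using Aut_emb_h[OF h0 \<rho>] by blast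
  have ev: "ev h (\<rho> gx) h = emb (smult c h)"
    using c(2) by (simp add: Endo_emb[OF E])
  \<comment> \<open>A positive degree of \<rho>(x) in t would show up N-fold in h(\<rho>(x)) = c h,
    which has degree 0 in t.\<close>
  have "degree (\<rho> gx) = 0"
  proof (rule ccontr)
    assume d: "degree (\<rho> gx) \<noteq> 0"
    then have "degree (ev h (\<rho> gx) h) = ?N * degree (\<rho> gx)"
      using degree_ev[of "\<rho> gx" h h] h0 by blast
    then show False
      using d h(2) by (simp add: ev emb_def)
  qed
  then obtain q where q: "\<rho> gx = emb q"
    by (metis degree_eq_zeroE emb_def)
  then have comp: "pcompose h q = smult c h"
    using ev by (simp add: ev_emb) (simp add: emb_def)
  have "?N * degree q = ?N"
    using c(1) by (simp add: comp flip: degree_pcompose)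
  then have "degree q = 1"
    using h(2) by auto
  then obtain b a where ba: "q = [:b, a:]" "a \<noteq> 0"
    using degree1_coeffs by metis
  obtain n where n: "?N = Suc n"
    using h(2) by (cases ?N) auto
  \<comment> \<open>Compare the leading coefficients in h(a x + b) = c h, where h is monic.\<close>
  have "c = a ^ ?N"
    using coeff_pcompose_linear_top[of h ?N b a] comp h(1) by (simp add: ba)
  moreover have "b = 0"
  proof -
    \<comment> \<open>Compare the coefficients of x^(N-1), where N = n + 1: that of c h is zero.
      Characteristic zero then allows division by N.\<close>
    have "a ^ n * (of_nat (Suc n) * b) = 0"
      using coeff_pcompose_linear_subtop[of h n b a] comp h(1,3) n by (simp add: ba(1))
    then show ?thesis
      using ba(2) by (simp del: of_nat_Suc)
  qed
  ultimately show ?thesis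
    using ba comp q by (intro exI[of _ a]) (simp add: gx_def emb_def)
qed

text \<open>Once \<rho>(x) = a x is known, \<rho>(h) = [\<rho>(t), a x] fixes the commutator of
  \<rho>(t) with x, so \<rho>(t) is a^(N-1) t up to the centralizer of x.\<close>

lemma Aut_eq_sigma_tau:
  fixes h :: "'k::field_char_0 poly"
  assumes h: "lead_coeff h = 1" "degree h \<ge> 1" "coeff h (degree h - 1) = 0"
    and \<rho>: "\<rho> \<in> Aut h"
  shows "\<exists>r a. a \<noteq> 0 \<and> pcompose h [:0, a:] = smult (a ^ degree h) h \<and>
    \<rho> = sigma h r \<circ> tau h a"
proof -
  let ?N = "degree h"
  have E: "\<rho> \<in> Endo h"
    using \<rho> by (rule Aut_Endo)
  have h0: "h \<noteq> 0"
    using h(2) by auto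
  obtain a where a: "a \<noteq> 0" "pcompose h [:0, a:] = smult (a ^ ?N) h" "\<rho> gx = smult [:a:] gx"
    using Aut_gx[OF assms] by blast
  have N: "a ^ ?N = a * a ^ (?N - 1)"
    using h(2) by (simp add: power_eq_if)
  let ?f = "\<rho> gt - smult [:a ^ (?N - 1):] gt"
  have "\<rho> (emb h) = smult [:a:] (skew_mult h (\<rho> gt) gx - skew_mult h gx (\<rho> gt))"
    by (subst emb_h_commutator)
      (simp add: Endo_diff[OF E] Endo_mult[OF E] a(3) skew_smult_left skew_smult_right
        smult_diff_right)
  moreover have "\<rho> (emb h) = smult [:a:] (smult [:a ^ (?N - 1):] (emb h))"
    by (simp add: Endo_emb[OF E] a(2,3) ev_scaled_gx N) (simp add: emb_def mult.commute)
  \<comment> \<open>Equate the two forms of \<rho>(h), as a commutator and as h(a x) = a^N h, and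
    cancel one factor a.\<close>
  ultimately have "skew_mult h (\<rho> gt) gx - skew_mult h gx (\<rho> gt)
      = smult [:a ^ (?N - 1):] (emb h)"
    using a(1) smult_cancel[of "[:a:]"] by (metis pCons_eq_0_iff)
  then have "skew_mult h ?f gx = skew_mult h gx ?f"
    by (simp add: emb_h_commutator[of h] skew_diff_left skew_diff_right skew_smult_left
        skew_smult_right smult_diff_right algebra_simps)
  then obtain p where p: "?f = emb p"
    using centralizer_gx[OF h0] by blast
  \<comment> \<open>As \<open>sigma h r \<circ> tau h a\<close> maps t to a^(N-1) (t + r), the
    summand p of \<rho>(t) has to be divided by a^(N-1).\<close>
  let ?r = "smult (inverse (a ^ (?N - 1))) p"
  have "\<rho> = sigma h ?r \<circ> tau h a"
  proof (rule Endo_eqI[OF E])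
    show "sigma h ?r \<circ> tau h a \<in> Endo h"
      using h(2) a(2) by (intro Endo_comp sigma_Endo tau_Endo)
    show "\<rho> gx = (sigma h ?r \<circ> tau h a) gx"
      by (simp add: a(3) sigma_tau_gx)
    have "smult [:a ^ (?N - 1):] (emb ?r) = emb p"
      using a(1) by (simp add: emb_def)
    then show "\<rho> gt = (sigma h ?r \<circ> tau h a) gt"
      using p by (simp add: sigma_tau_gt smult_add_right algebra_simps)
  qed
  then show ?thesis
    using a by blast
qed

section \<open>Commutation with Delta\<close>

lemma sigma_tau_emb:
  assumes "degree h \<ge> 1" "pcompose h [:0, a:] = smult (a ^ degree h) h"
  shows "sigma h r (tau h a (emb p)) = emb (pcompose p [:0, a:])"
proof -
  have "sigma h r \<circ> tau h a \<in> Endo h"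
    using assms by (intro Endo_comp sigma_Endo tau_Endo)
  from Endo_emb[OF this, of p] show ?thesis
    by (simp add: sigma_tau_gx ev_scaled_gx)
qed

lemma Delta_emb: "Delta h s (emb p) = 0"
  by (simp add: emb_def Delta_pCons)

lemma Delta_skew_mult:
  "Delta h s (skew_mult h f g) = skew_mult h (Delta h s f) g + skew_mult h f (Delta h s g)"
  using Delta_Der[of h s] by (simp add: Der_def)

text \<open>Right multiplication by t is the plain shift, so induction along \<open>pCons\<close>
  peels off one right factor t.\<close>

lemma pCons_eq_skew: "pCons p f = emb p + skew_mult h f gt"
  by (simp add: skew_gt_right emb_def)

text \<open>Both sides are additive and obey the same Leibniz rule twisted by \<rho>; they vanish on
  k[x] and agree at t.\<close>

lemma sigma_tau_Delta:
  assumes h: "degree h \<ge> 1" "pcompose h [:0, a:] = smult (a ^ degree h) h"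
    and s: "pcompose s [:0, a:] = smult (a ^ (degree h - 1)) s"
  shows "sigma h r (tau h a (Delta h s u)) = Delta h s (sigma h r (tau h a u))"
proof -
  define \<rho> where "\<rho> = sigma h r \<circ> tau h a"
  have E: "\<rho> \<in> Endo h"
    using h unfolding \<rho>_def by (intro Endo_comp sigma_Endo tau_Endo)
  have emb: "\<rho> (emb p) = emb (pcompose p [:0, a:])" for p
    using h by (simp add: \<rho>_def sigma_tau_emb)
  \<comment> \<open>Here the hypothesis on s enters: \<rho>(s) = s(a x) = a^(N-1) s, and
    \<open>Delta\<close> sends a^(N-1) (t + r) to a^(N-1) s.\<close>
  have gt: "Delta h s (\<rho> gt) = \<rho> (emb s)"
    by (simp add: emb s, simp add: \<rho>_def sigma_tau_gt Delta_smult Delta_add Delta_gt Delta_emb,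
      simp add: emb_def)
  have "\<rho> (Delta h s u) = Delta h s (\<rho> u)"
  proof (induction u)
    case 0
    have "\<rho> 0 = 0"
      using Endo_diff[OF E, of 0 0] by simp
    then show ?case
      by simp
  next
    case (pCons p f)
    have "\<rho> (Delta h s (pCons p f))
        = skew_mult h (\<rho> (Delta h s f)) (\<rho> gt) + skew_mult h (\<rho> f) (\<rho> (emb s))"
      by (simp add: Delta_pCons Endo_add[OF E] Endo_mult[OF E])
    also have "\<dots> = Delta h s (\<rho> (emb p) + skew_mult h (\<rho> f) (\<rho> gt))"
      by (simp add: Delta_add emb Delta_emb Delta_skew_mult pCons.IH gt)
    also have "\<dots> = Delta h s (\<rho> (pCons p f))"
      by (simp add: pCons_eq_skew[of p f h] Endo_add[OF E] Endo_mult[OF E])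
    finally show ?case .
  qed
  then show ?thesis
    by (simp add: \<rho>_def)
qed

section \<open>Inner derivations and the commutation criterion\<close>

lemma ad_diff_left: "ad h (v - w) u = ad h v u - ad h w u"
  by (simp add: ad_def skew_diff_left skew_diff_right)

lemma ad_add_right: "ad h w (u + v) = ad h w u + ad h w v"
  by (simp add: ad_def skew_add_left skew_add_right)

lemma ad_smult_right: "ad h w (smult [:c:] u) = smult [:c:] (ad h w u)"
  by (simp add: ad_def skew_smult_left skew_smult_right smult_diff_right)

lemma ad_scal: "ad h (scal c) u = 0"
  using scal_central[of h u c] by (simp add: ad_def)

lemma ad_emb_emb: "ad h (emb p) (emb q) = 0"
  using emb_mult[of h p q] emb_mult[of h q p] by (simp add: ad_def mult.commute)

lemma ad_emb_gt: "ad h (emb p) gt = emb (- (h * pderiv p))"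
  by (rule poly_eqI)
    (simp add: ad_def skew_gt_left skew_gt_right coeff_t_mult emb_def coeff_pCons split: nat.split)

lemma Endo_ad: "\<phi> \<in> Endo h \<Longrightarrow> \<phi> (ad h w u) = ad h (\<phi> w) (\<phi> u)"
  by (simp add: ad_def Endo_diff Endo_mult)

lemma commutes_sigma_tau_iff:
  fixes h s :: "'k::field_char_0 poly"
  assumes h: "degree h \<ge> 1" "pcompose h [:0, a:] = smult (a ^ degree h) h"
    and a: "a \<noteq> 0" and s: "degree s < degree h"
    and D: "D = (\<lambda>u. ad h w u + Delta h s u)" and \<rho>: "\<rho> = sigma h r \<circ> tau h a"
  shows "\<rho> \<circ> D = D \<circ> \<rho> \<longleftrightarrow>
    \<rho> w - w \<in> range scal \<and> pcompose s [:0, a:] = smult (a ^ (degree h - 1)) s"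
proof
  let ?c = "a ^ (degree h - 1)"
  have E: "\<rho> \<in> Endo h"
    using h unfolding \<rho> by (intro Endo_comp sigma_Endo tau_Endo)
  have gx: "\<rho> gx = smult [:a:] gx" and gt: "\<rho> gt = smult [:?c:] (gt + emb r)"
    by (simp_all add: \<rho> sigma_tau_gx sigma_tau_gt)
  have emb: "\<rho> (emb p) = emb (pcompose p [:0, a:])" for p
    using h by (simp add: \<rho> sigma_tau_emb)
  {
    assume "\<rho> \<circ> D = D \<circ> \<rho>"
    then have "\<rho> (D u) = D (\<rho> u)" for u
      by (metis comp_apply)
    then have "ad h (\<rho> w) (\<rho> u) + \<rho> (Delta h s u) = ad h w (\<rho> u) + Delta h s (\<rho> u)" for u
      by (simp add: D Endo_add[OF E] Endo_ad[OF E])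
    \<comment> \<open>So \<open>ad\<close> of \<rho>(w) - w measures the failure of \<rho> to
      commute with \<open>Delta\<close>; it is tested at the generators u = x and u = t.\<close>
    then have z: "ad h (\<rho> w - w) (\<rho> u) = Delta h s (\<rho> u) - \<rho> (Delta h s u)" for u
      by (simp add: ad_diff_left algebra_simps)
    have "\<rho> 0 = 0"
      using Endo_diff[OF E, of 0 0] by simp
    then have "smult [:a:] (ad h (\<rho> w - w) gx) = 0"
      using z[of gx] by (simp add: gx Delta_gx Delta_smult ad_smult_right)
    then have "skew_mult h (\<rho> w - w) gx = skew_mult h gx (\<rho> w - w)"
      using a by (simp add: ad_def)
    then obtain p where p: "\<rho> w - w = emb p"
      using centralizer_gx[of h] h(1) by force
    \<comment> \<open>At u = t the summand r of \<rho>(t) drops out: it commutes with p and is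
      killed by \<open>Delta\<close>.\<close>
    have "emb (- smult ?c (h * pderiv p)) = emb (smult ?c s - pcompose s [:0, a:])"
      using z[of gt]
      by (simp add: p gt Delta_smult Delta_add Delta_gt Delta_emb emb ad_smult_right ad_add_right
          ad_emb_emb ad_emb_gt) (simp add: emb_def)
    then have eq: "smult ?c (h * pderiv p) = pcompose s [:0, a:] - smult ?c s"
      by (simp add: emb_def algebra_simps)
    have "degree (pcompose s [:0, a:] - smult ?c s) \<le> degree s"
      by (intro degree_diff_le) (use a in \<open>simp_all add: degree_pcompose\<close>)
    then have "degree (smult ?c (h * pderiv p)) < degree h"
      using s by (simp only: eq)
    then have "degree (h * pderiv p) < degree h"
      using a by simp
    \<comment> \<open>A nonzero \<open>pderiv p\<close> would give the product at least the degree
      of h.\<close>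
    then have dp: "pderiv p = 0"
      using degree_mult_right_le[of "pderiv p" h] by linarith
    then have "p = [:coeff p 0:]"
      by (metis degree_0_id pderiv_eq_0_iff)
    then have "\<rho> w - w = scal (coeff p 0)"
      using p by (simp add: scal_def)
    then show "\<rho> w - w \<in> range scal \<and> pcompose s [:0, a:] = smult ?c s"
      using eq dp by auto
  }
  \<comment> \<open>Conversely, scalars are central, so \<rho>(w) and w induce the same inner
    derivation and \<rho> commutes with each summand of D.\<close>
  assume "\<rho> w - w \<in> range scal \<and> pcompose s [:0, a:] = smult ?c s"
  then obtain c where c: "\<rho> w - w = scal c" and sc: "pcompose s [:0, a:] = smult ?c s"
    by blast
  have "ad h (\<rho> w) u = ad h w u" for u
    using ad_diff_left[of h "\<rho> w" w u] by (simp add: c ad_scal)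
  moreover have "\<rho> (Delta h s u) = Delta h s (\<rho> u)" for u
    using sigma_tau_Delta[OF h sc] by (simp add: \<rho>)
  ultimately show "\<rho> \<circ> D = D \<circ> \<rho>"
    by (simp add: fun_eq_iff D Endo_add[OF E] Endo_ad[OF E])
qed

theorem corollary21:
  fixes h s :: "'k::{alg_closed_field, field_char_0} poly"
    and w :: "'k poly poly"
    and D :: "'k poly poly \<Rightarrow> 'k poly poly"
  assumes "lead_coeff h = 1"
    and "degree h \<ge> 1"
    and "coeff h (degree h - 1) = 0"
    and "degree s < degree h"
    and "D = (\<lambda>u. ad h w u + Delta h s u)"
  shows "Aut_commuting h D =
    {\<rho> \<in> Aut h. \<exists>r a. a \<noteq> 0 \<and> pcompose h [:0, a:] = smult (a ^ degree h) h \<and>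
        \<rho> = sigma h r \<circ> tau h a \<and>
        \<rho> w - w \<in> range scal \<and>
        pcompose s [:0, a:] = smult (a ^ (degree h - 1)) s}"
proof -
  \<comment> \<open>From left to right the decomposition of \<rho> supplies r and a; from right to
    left they are given. The criterion applies to either pair.\<close>
  have "\<rho> \<circ> D = D \<circ> \<rho> \<longleftrightarrow> (\<exists>r a. a \<noteq> 0 \<and> pcompose h [:0, a:] = smult (a ^ degree h) h \<and>
        \<rho> = sigma h r \<circ> tau h a \<and>
        \<rho> w - w \<in> range scal \<and>
        pcompose s [:0, a:] = smult (a ^ (degree h - 1)) s)" if "\<rho> \<in> Aut h" for \<rho>
    using Aut_eq_sigma_tau[OF assms(1-3) that]
      commutes_sigma_tau_iff[OF assms(2) _ _ assms(4,5), of _ \<rho>]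
    by metis
  then show ?thesis
    by (auto simp: Aut_commuting_def)
qed

end
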